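(* Consider the closed-loop mixed-traffic system defined in the context, in which the head CAV uses the nominal controller $u_H=k_{H,\mathrm n}(x,v_d)$ and the range policy $V_H$ given there. Let $\tau_H>0$, $h_H(x)=s_H-\tau_Hv_H$ and $\mathcal C_H=\{x\in\mathbb{R}^n:h_H(x)\ge0\}$. Suppose that $v_d,v_H,v_i,v_T\in[0,v_{\max}]$ ($i=1,\dots,N$) and $s_H\in[s_{\mathrm{st}},s_{\mathrm{go}}]$, and that the controller parameters satisfy $\kappa\le1/\tau_H$ and $$\alpha_H\ge\Big(|1-\tau_H\beta_{H,d}|+\tau_H\sum_{i\in\mathcal N_H}|\beta_{H,i}|+\tau_H|\beta_{H,T}|\Big)\frac{v_{\max}}{s_{\mathrm{st}}}.$$ Then the system is safe with respect to $\mathcal C_H$; that is, along any solution for which $v_d(t),v_H(t),v_i(t),v_T(t)\in[0,v_{\max}]$ ($i=1,\dots,N$) and $s_H(t)\in[s_{\mathrm{st}},s_{\mathrm{go}}]$ hold for all $t\ge0$, $x(0)\in\mathcal C_H$ implies $x(t)\in\mathcal C_H$ for all $t\ge0$.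
   Context: A platoon consists of a head CAV (H), $N$ human-driven vehicles HV-$1,\dots,$HV-$N$, and a tail CAV (T), behind a leading vehicle with speed $v_d(t)$ (external disturbance). State: $x=[s_H,v_H,s_1,v_1,\dots,s_N,v_N,s_T,v_T]^\top\in\mathbb{R}^n$, $n=2N+4$ (gaps $s$ and speeds $v$). With $v_0:=v_H$ the closed-loop dynamics are $$\dot s_H=v_d-v_H,\quad\dot v_H=k_{H,\mathrm n}(x,v_d),\qquad\dot s_i=v_{i-1}-v_i,\quad\dot v_i=F_i(s_i,v_i,v_{i-1}-v_i)\ (i=1,\dots,N),$$ $$\dot s_T=v_N-v_T,\quad\dot v_T=k_{T,\mathrm n}(x),$$ where $F_i:\mathbb{R}^3\to\mathbb{R}$ are general car-following acceleration functions, and the nominal controllers are $$k_{H,\mathrm n}(x,v_d)=\alpha_H(V_H(s_H)-v_H)+\beta_{H,d}(W(v_d)-v_H)+\sum_{i\in\mathcal N_H}\beta_{H,i}(W(v_i)-v_H)+\beta_{H,T}(W(v_T)-v_H),$$ $$k_{T,\mathrm n}(x)=\alpha_T(V_T(s_T)-v_T)+\beta_{T,N}(W(v_N)-v_T)+\sum_{i\in\mathcal N_T}\beta_{T,i}(W(v_i)-v_T)+\beta_{T,H}(W(v_H)-v_T),$$ with real gains $\alpha,\beta$, index sets $\mathcal N_H\subseteq\{1,\dots,N\}$, $\mathcal N_T\subseteq\{1,\dots,N-1\}$, and $W(v)=\min\{v,v_{\max}\}$. The range policy is $V_H(s)=V_T(s)=0$ for $s\le s_{\mathrm{st}}$, $\kappa(s-s_{\mathrm{st}})$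 for $s_{\mathrm{st}}<s<s_{\mathrm{go}}$, and $v_{\max}$ for $s\ge s_{\mathrm{go}}$, where $v_{\max}>0$, $0<s_{\mathrm{st}}<s_{\mathrm{go}}$ and $\kappa=v_{\max}/(s_{\mathrm{go}}-s_{\mathrm{st}})$. "Safe with respect to $\mathcal C$" means that $\mathcal C$ is forward invariant: $x(0)\in\mathcal C$ implies $x(t)\in\mathcal C$ for all $t\ge0$. *)

theory Defs
  imports "HOL-Analysis.Analysis"
begin

text \<open>
  A state \<open>x = [s\<^sub>H, v\<^sub>H, s\<^sub>1, v\<^sub>1, \<dots>, s\<^sub>N, v\<^sub>N, s\<^sub>T, v\<^sub>T]\<close> is a vector of length
  \<open>n = 2N + 4\<close> with coordinates numbered from 0. Since \<open>N\<close> is a parameter of the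
  system, \<open>\<real>\<^sup>n\<close> is rendered as the set of functions on \<open>{..<n}\<close>.
  Vehicle 0 is the head CAV, vehicles 1 to \<open>N\<close> are the human-driven
  vehicles, and vehicle \<open>N + 1\<close> is the tail CAV; in particular \<open>v\<^sub>0 = v\<^sub>H\<close> by construction.
\<close>

type_synonym state = "nat \<Rightarrow> real"

definition state_space :: "nat \<Rightarrow> state set" where
  "state_space N = {..<2 * N + 4} \<rightarrow>\<^sub>E (UNIV :: real set)"

definition gap :: "state \<Rightarrow> nat \<Rightarrow> real" where
  "gap x i = x (2 * i)"

definition speed :: "state \<Rightarrow> nat \<Rightarrow> real" where
  "speed x i = x (2 * i + 1)"

text \<open>
  The gain \<open>\<beta>\<^bsub>T,N\<^esub>\<close> is the value of \<open>gain_T_HV\<close> at \<open>N\<close>, which does not interfere with the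
  gains \<open>\<beta>\<^bsub>T,i\<^esub>\<close> for \<open>i \<in> \<N>\<^sub>T\<close> because \<open>N \<notin> \<N>\<^sub>T\<close>.
\<close>

record platoon =
  num_HV :: nat
  v_max :: real
  s_st :: real
  s_go :: real
  car_following :: "nat \<Rightarrow> real \<Rightarrow> real \<Rightarrow> real \<Rightarrow> real"  (* F_i (gap, speed, relative speed) *)
  alpha_H :: real
  gain_H_d :: real
  gain_H_HV :: "nat \<Rightarrow> real"
  gain_H_T :: real
  links_H :: "nat set"
  alpha_T :: real
  gain_T_HV :: "nat \<Rightarrow> real"
  gain_T_H :: real
  links_T :: "nat set"

definition valid_platoon :: "platoon \<Rightarrow> bool" where
  "valid_platoon p \<longleftrightarrow>
     0 < v_max p \<and> 0 < s_st p \<and> s_st p < s_go p \<and>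
     links_H p \<subseteq> {1..num_HV p} \<and> links_T p \<subseteq> {1..<num_HV p}"

definition kappa :: "platoon \<Rightarrow> real" where
  "kappa p = v_max p / (s_go p - s_st p)"

text \<open>The common range policy \<open>V\<^sub>H = V\<^sub>T\<close>.\<close>

definition range_policy :: "platoon \<Rightarrow> real \<Rightarrow> real" where
  "range_policy p s =
     (if s \<le> s_st p then 0
      else if s < s_go p then kappa p * (s - s_st p)
      else v_max p)"

definition speed_policy :: "platoon \<Rightarrow> real \<Rightarrow> real" where
  "speed_policy p v = min v (v_max p)"

definition k_H_nominal :: "platoon \<Rightarrow> state \<Rightarrow> real \<Rightarrow> real" where
  "k_H_nominal p x w =
     (let v = speed x; N = num_HV p; W = speed_policy p in
        alpha_H p * (range_policy p (gap x 0) - v 0)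
      + gain_H_d p * (W w - v 0)
      + (\<Sum>i\<in>links_H p. gain_H_HV p i * (W (v i) - v 0))
      + gain_H_T p * (W (v (N + 1)) - v 0))"

definition k_T_nominal :: "platoon \<Rightarrow> state \<Rightarrow> real" where
  "k_T_nominal p x =
     (let v = speed x; N = num_HV p; W = speed_policy p in
        alpha_T p * (range_policy p (gap x (N + 1)) - v (N + 1))
      + gain_T_HV p N * (W (v N) - v (N + 1))
      + (\<Sum>i\<in>links_T p. gain_T_HV p i * (W (v i) - v (N + 1)))
      + gain_T_H p * (W (v 0) - v (N + 1)))"

text \<open>
  Classical solutions on \<open>[0, \<infinity>)\<close> of the closed-loop dynamics with lead speed \<open>v_d\<close>
  (one-sided derivative at time 0).
\<close>

definition closed_loop_solution :: "platoon \<Rightarrow> (real \<Rightarrow> real) \<Rightarrow> (real \<Rightarrow> state) \<Rightarrow> bool" where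
  "closed_loop_solution p v_d x \<longleftrightarrow>
     (let N = num_HV p; s = (\<lambda>i t. gap (x t) i); v = (\<lambda>i t. speed (x t) i) in
      \<forall>t\<ge>0.
        x t \<in> state_space N
      \<and> (s 0 has_real_derivative v_d t - v 0 t) (at t within {0..})
      \<and> (v 0 has_real_derivative k_H_nominal p (x t) (v_d t)) (at t within {0..})
      \<and> (\<forall>i\<in>{1..N}.
           (s i has_real_derivative v (i - 1) t - v i t) (at t within {0..})
         \<and> (v i has_real_derivative car_following p i (s i t) (v i t) (v (i - 1) t - v i t))
             (at t within {0..}))
      \<and> (s (N + 1) has_real_derivative v N t - v (N + 1) t) (at t within {0..})
      \<and> (v (N + 1) has_real_derivative k_T_nominal p (x t)) (at t within {0..}))"

definition operating_range :: "platoon \<Rightarrow> real \<Rightarrow> state \<Rightarrow> bool" where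
  "operating_range p w x \<longleftrightarrow>
     w \<in> {0..v_max p} \<and> (\<forall>i\<in>{0..num_HV p + 1}. speed x i \<in> {0..v_max p})
     \<and> gap x 0 \<in> {s_st p..s_go p}"

definition h_H :: "real \<Rightarrow> state \<Rightarrow> real" where
  "h_H \<tau> x = gap x 0 - \<tau> * speed x 0"

definition C_H :: "nat \<Rightarrow> real \<Rightarrow> state set" where
  "C_H N \<tau> = {x \<in> state_space N. h_H \<tau> x \<ge> 0}"

text \<open>Safety, i.e. forward invariance of \<open>C\<close> along a given family \<open>X\<close> of trajectories.\<close>

definition safe_wrt :: "(real \<Rightarrow> state) set \<Rightarrow> state set \<Rightarrow> bool" where
  "safe_wrt X C \<longleftrightarrow> (\<forall>x\<in>X. x 0 \<in> C \<longrightarrow> (\<forall>t\<ge>0. x t \<in> C))"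

end

theory Submission
  imports Defs
begin

text \<open>
  Since \<open>\<kappa> \<le> 1 / \<tau>\<^sub>H\<close>, the range policy satisfies \<open>\<tau>\<^sub>H V\<^sub>H(s\<^sub>H) \<le> s\<^sub>H - s\<^sub>s\<^sub>t\<close>, that is
  \<open>\<tau>\<^sub>H (v\<^sub>H - V\<^sub>H(s\<^sub>H)) \<ge> s\<^sub>s\<^sub>t - h\<^sub>H\<close>. All speed differences are at most \<open>v\<^sub>m\<^sub>a\<^sub>x\<close>, so the bound on
  \<open>\<alpha>\<^sub>H\<close> lets \<open>\<alpha>\<^sub>H s\<^sub>s\<^sub>t\<close> absorb every other term of the derivative of \<open>h\<^sub>H\<close>. This leaves
  \<open>h\<^sub>H' \<ge> - \<alpha>\<^sub>H h\<^sub>H\<close>, and hence \<open>exp (\<alpha>\<^sub>H t) h\<^sub>H\<close> is nondecreasing.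
\<close>

lemma nonneg_of_linear_derivative_bound:
  fixes h h' :: "real \<Rightarrow> real" and a :: real
  assumes deriv: "\<And>t. t \<ge> 0 \<Longrightarrow> (h has_real_derivative h' t) (at t within {0..})"
    and bound: "\<And>t. t \<ge> 0 \<Longrightarrow> h' t \<ge> - a * h t"
    and "h 0 \<ge> 0" and "t \<ge> 0"
  shows "h t \<ge> 0"
proof -
  define g where "g = (\<lambda>t. exp (a * t) * h t)"
  have exp_deriv: "((\<lambda>t. exp (a * t)) has_real_derivative a * exp (a * t)) (at t within {0..})" for t
    by (auto intro!: derivative_eq_intros)
  have g_deriv: "(g has_real_derivative exp (a * t) * (h' t + a * h t)) (at t within {0..})"
    if "t \<ge> 0" for t
    unfolding g_def
    by (rule DERIV_cong[OF DERIV_mult[OF exp_deriv deriv[OF that]]]) (simp add: algebra_simps)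
  have "continuous_on {0..t} g"
    by (rule continuous_on_subset[OF DERIV_continuous_on[OF g_deriv]]) auto
  then have "g 0 \<le> g t"
  \<comment> \<open>At time 0 only a one-sided derivative exists, so monotonicity is taken from
    continuity on \<open>{0..t}\<close> and the derivative at interior points, where
    \<open>at u within {0..}\<close> is \<open>at u\<close>.\<close>
  proof (rule DERIV_nonneg_imp_increasing_open[OF \<open>t \<ge> 0\<close>, rotated])
    fix u assume u: "0 < u" "u < t"
    then have "(g has_real_derivative exp (a * u) * (h' u + a * h u)) (at u)"
      using g_deriv[of u] at_within_interior[of u "{0..}"] by simp
    moreover have "exp (a * u) * (h' u + a * h u) \<ge> 0"
      using bound[of u] u by simp
    ultimately show "\<exists>y. (g has_real_derivative y) (at u) \<and> y \<ge> 0"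
      by blast
  qed
  then have "0 \<le> exp (a * t) * h t"
    using \<open>h 0 \<ge> 0\<close> by (simp add: g_def)
  then show ?thesis
    by (simp add: zero_le_mult_iff)
qed

lemma range_policy_le:
  assumes "valid_platoon p" and "\<tau> > 0" and "kappa p \<le> 1 / \<tau>"
    and "s \<in> {s_st p..s_go p}"
  shows "\<tau> * range_policy p s \<le> s - s_st p"
proof -
  \<comment> \<open>The affine branch also gives the right values at both endpoints: 0 at
    \<open>s_st p\<close> and \<open>v_max p\<close> at \<open>s_go p\<close>.\<close>
  have "range_policy p s = kappa p * (s - s_st p)"
    using assms by (auto simp: range_policy_def valid_platoon_def kappa_def)
  moreover have "\<tau> * kappa p \<le> 1"
    using assms by (simp add: field_simps)
  ultimately show ?thesis
    using mult_right_mono[of "\<tau> * kappa p" 1 "s - s_st p"] assms(4) by (simp add: mult.assoc)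
qed

text \<open>The left side is the derivative of \<open>h_H\<close> along the flow. Its terms without
  \<open>alpha_H p\<close> are at least \<open>- B * v_max p\<close>, where \<open>B\<close> is the
  bracket in the gain condition; the range policy term contributes at least
  \<open>alpha_H p * (s_st p - h_H \<tau> x)\<close>, and \<open>alpha_H p * s_st p\<close>
  dominates \<open>B * v_max p\<close>.\<close>

lemma h_H_derivative_bound:
  assumes valid: "valid_platoon p" and \<tau>: "\<tau> > 0" and \<kappa>: "kappa p \<le> 1 / \<tau>"
    and \<alpha>: "alpha_H p \<ge>
           (\<bar>1 - \<tau> * gain_H_d p\<bar> + \<tau> * (\<Sum>i\<in>links_H p. \<bar>gain_H_HV p i\<bar>)
             + \<tau> * \<bar>gain_H_T p\<bar>) * (v_max p / s_st p)"
    and range: "operating_range p w x"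
  shows "w - speed x 0 - \<tau> * k_H_nominal p x w \<ge> - alpha_H p * h_H \<tau> x"
proof -
  let ?N = "num_HV p" and ?v = "speed x" and ?M = "v_max p"
  define S where "S = (\<Sum>i\<in>links_H p. gain_H_HV p i * (?v i - ?v 0))"
  define B where "B = \<bar>1 - \<tau> * gain_H_d p\<bar> + \<tau> * (\<Sum>i\<in>links_H p. \<bar>gain_H_HV p i\<bar>)
             + \<tau> * \<bar>gain_H_T p\<bar>"
  have links: "links_H p \<subseteq> {1..?N}" and M: "?M > 0" and st: "s_st p > 0"
    using valid by (auto simp: valid_platoon_def)
  have v: "?v i \<in> {0..?M}" if "i \<le> ?N + 1" for i
    using range that by (auto simp: operating_range_def)
  have w: "w \<in> {0..?M}" and s: "gap x 0 \<in> {s_st p..s_go p}"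
    using range by (auto simp: operating_range_def)
  have abs_diff: "\<bar>c * (u - ?v 0)\<bar> \<le> \<bar>c\<bar> * ?M" if "u \<in> {0..?M}" for c u
    unfolding abs_mult using that v[of 0] by (intro mult_left_mono) auto
  \<comment> \<open>The saturation is inactive in the operating range, so the controller is linear
    in the speeds there.\<close>
  have W: "speed_policy p u = u" if "u \<in> {0..?M}" for u
    using that by (simp add: speed_policy_def)
  have W_links: "speed_policy p (?v i) = ?v i" if "i \<in> links_H p" for i
    using links that by (intro W v) auto
  have W_T: "speed_policy p (?v (?N + 1)) = ?v (?N + 1)"
    by (intro W v) simp
  have k: "k_H_nominal p x w = alpha_H p * (range_policy p (gap x 0) - ?v 0)
      + gain_H_d p * (w - ?v 0) + S + gain_H_T p * (?v (?N + 1) - ?v 0)"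
    unfolding k_H_nominal_def Let_def S_def W[OF w] W_T by (simp add: W_links)
  have "\<bar>S\<bar> \<le> (\<Sum>i\<in>links_H p. \<bar>gain_H_HV p i\<bar> * ?M)"
    unfolding S_def using links
    by (intro order_trans[OF sum_abs] sum_mono abs_diff v) auto
  then have "\<tau> * S \<le> \<tau> * ((\<Sum>i\<in>links_H p. \<bar>gain_H_HV p i\<bar>) * ?M)"
    using \<tau> by (simp add: sum_distrib_right)
  moreover have "\<tau> * (gain_H_T p * (?v (?N + 1) - ?v 0)) \<le> \<tau> * (\<bar>gain_H_T p\<bar> * ?M)"
    using \<tau> abs_diff[OF v, of "?N + 1" "gain_H_T p"] by (intro mult_left_mono) auto
  \<comment> \<open>The difference \<open>w - ?v 0\<close> enters both through the gap dynamics and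
    through the feedback on the lead speed. Merging the two gives the coefficient
    \<open>1 - \<tau> * gain_H_d p\<close>.\<close>
  moreover have "- ((1 - \<tau> * gain_H_d p) * (w - ?v 0)) \<le> \<bar>1 - \<tau> * gain_H_d p\<bar> * ?M"
    using abs_diff[OF w, of "1 - \<tau> * gain_H_d p"] by linarith
  ultimately have gains: "(1 - \<tau> * gain_H_d p) * (w - ?v 0) - \<tau> * S
      - \<tau> * (gain_H_T p * (?v (?N + 1) - ?v 0)) \<ge> - (B * ?M)"
    by (simp add: B_def algebra_simps)
  have "B \<ge> 0"
    using \<tau> by (simp add: B_def sum_nonneg)
  have B_le: "B * (?M / s_st p) \<le> alpha_H p"
    using \<alpha> by (simp add: B_def)
  then have B_M: "B * ?M \<le> alpha_H p * s_st p"
    using st by (simp add: field_simps)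
  \<comment> \<open>The sign of \<open>alpha_H p\<close> follows from the gain condition; it allows
    the range policy estimate to be multiplied by \<open>alpha_H p\<close>.\<close>
  have "0 \<le> B * (?M / s_st p)"
    using \<open>B \<ge> 0\<close> M st by simp
  then have "alpha_H p \<ge> 0"
    using B_le by linarith
  then have "alpha_H p * (s_st p - h_H \<tau> x) \<le> alpha_H p * (\<tau> * (?v 0 - range_policy p (gap x 0)))"
    using range_policy_le[OF valid \<tau> \<kappa> s]
    by (intro mult_left_mono) (auto simp: h_H_def algebra_simps)
  with gains B_M show ?thesis
    by (simp add: k algebra_simps)
qed

theorem theorem2:
  fixes p :: platoon and \<tau>\<^sub>H :: real and v_d :: "real \<Rightarrow> real"
  assumes "valid_platoon p"
    and "\<tau>\<^sub>H > 0"
    and "kappa p \<le> 1 / \<tau>\<^sub>H"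
    and "alpha_H p \<ge>
           (\<bar>1 - \<tau>\<^sub>H * gain_H_d p\<bar> + \<tau>\<^sub>H * (\<Sum>i\<in>links_H p. \<bar>gain_H_HV p i\<bar>)
             + \<tau>\<^sub>H * \<bar>gain_H_T p\<bar>) * (v_max p / s_st p)"
  shows "safe_wrt
           {x. closed_loop_solution p v_d x \<and> (\<forall>t\<ge>0. operating_range p (v_d t) (x t))}
           (C_H (num_HV p) \<tau>\<^sub>H)"
  unfolding safe_wrt_def
proof (intro ballI impI allI)
  fix x and t :: real
  assume "x \<in> {x. closed_loop_solution p v_d x \<and> (\<forall>t\<ge>0. operating_range p (v_d t) (x t))}"
  then have sol: "closed_loop_solution p v_d x"
    and range: "\<And>t. t \<ge> 0 \<Longrightarrow> operating_range p (v_d t) (x t)"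
    by auto
  assume "x 0 \<in> C_H (num_HV p) \<tau>\<^sub>H" and "t \<ge> 0"
  have space: "x t \<in> state_space (num_HV p)"
    and s_deriv: "((\<lambda>t. gap (x t) 0) has_real_derivative v_d t - speed (x t) 0) (at t within {0..})"
    and v_deriv: "((\<lambda>t. speed (x t) 0) has_real_derivative k_H_nominal p (x t) (v_d t))
      (at t within {0..})"
    if "t \<ge> 0" for t
    using sol[unfolded closed_loop_solution_def Let_def, rule_format, OF that] by blast+
  have h_deriv: "((\<lambda>t. h_H \<tau>\<^sub>H (x t)) has_real_derivative
      v_d t - speed (x t) 0 - \<tau>\<^sub>H * k_H_nominal p (x t) (v_d t)) (at t within {0..})"
    if "t \<ge> 0" for t
    unfolding h_H_def
    by (rule DERIV_diff[OF s_deriv[OF that] DERIV_cmult[OF v_deriv[OF that]]])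
  have "h_H \<tau>\<^sub>H (x 0) \<ge> 0"
    using \<open>x 0 \<in> C_H (num_HV p) \<tau>\<^sub>H\<close> by (simp add: C_H_def)
  then have "h_H \<tau>\<^sub>H (x t) \<ge> 0"
    using \<open>t \<ge> 0\<close>
    by (rule nonneg_of_linear_derivative_bound[where h = "\<lambda>t. h_H \<tau>\<^sub>H (x t)", rotated 2])
      (rule h_deriv h_H_derivative_bound[OF assms range], assumption)+
  then show "x t \<in> C_H (num_HV p) \<tau>\<^sub>H"
    using space[OF \<open>t \<ge> 0\<close>] by (simp add: C_H_def)
qed

end
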